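(* Let $G$ be a finite simple graph that is $\alpha_1^{+}$-stable, let $v$ be the vertex with $\{v\}=\bigcap\{S:S\in\Omega(G)\}$, and let $G_0=G-N[v]$ be the subgraph induced by the vertices not in the closed neighbourhood $N[v]=N(v)\cup\{v\}$. Then $G$ is $\alpha_{P_3}^{+}$-stable if and only if for every pair of vertices $x,y\in V(G_0)$ there exists $S_0\in\Omega(G_0)$ with $x,y\in V(G_0)-S_0$.
   Context: $\alpha(G)$ is the maximum size of a stable set; $\Omega(G)$ is the set of maximum stable sets; $\xi(G)=|\bigcap\{S:S\in\Omega(G)\}|$. $G$ is $\alpha_1^{+}$-stable if $\xi(G)=1$. For $e\in E(\overline{G})$ (a pair of distinct non-adjacent vertices), $G+e$ denotes $G$ with $e$ added. $G$ is $\alpha_{P_3}^{+}$-stable if $\alpha(G+e_1+e_2)=\alpha(G)$ for any $e_1,e_2\in E(\overline{G})$ (not necessarily distinct) having a common endpoint. *)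

theory Defs
  imports "HOL-Library.Ramsey"
begin

text \<open>A graph is a pair \<open>(V, E)\<close> whose edges are two-element subsets of \<open>V\<close>.\<close>

type_synonym 'a ugraph = "'a set \<times> 'a set set"

abbreviation gverts :: "'a ugraph \<Rightarrow> 'a set" where
  "gverts G \<equiv> fst G"

abbreviation gedges :: "'a ugraph \<Rightarrow> 'a set set" where
  "gedges G \<equiv> snd G"

definition finite_simple_graph :: "'a ugraph \<Rightarrow> bool" where
  "finite_simple_graph G \<longleftrightarrow> finite (gverts G) \<and> gedges G \<subseteq> [gverts G]\<^bsup>2\<^esup>"

definition complement :: "'a ugraph \<Rightarrow> 'a ugraph" where
  "complement G = (gverts G, [gverts G]\<^bsup>2\<^esup> - gedges G)"

definition add_edge :: "'a ugraph \<Rightarrow> 'a set \<Rightarrow> 'a ugraph" where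
  "add_edge G e = (gverts G, insert e (gedges G))"

definition induced_subgraph :: "'a ugraph \<Rightarrow> 'a set \<Rightarrow> 'a ugraph" where
  "induced_subgraph G W = (W, gedges G \<inter> [W]\<^bsup>2\<^esup>)"

definition open_nbhd :: "'a ugraph \<Rightarrow> 'a \<Rightarrow> 'a set" where
  "open_nbhd G v = {u \<in> gverts G. {u, v} \<in> gedges G}"

definition closed_nbhd :: "'a ugraph \<Rightarrow> 'a \<Rightarrow> 'a set" where
  "closed_nbhd G v = open_nbhd G v \<union> {v}"

definition stable_set :: "'a ugraph \<Rightarrow> 'a set \<Rightarrow> bool" where
  "stable_set G S \<longleftrightarrow> S \<subseteq> gverts G \<and> indep S (gedges G)"

definition stability_number :: "'a ugraph \<Rightarrow> nat" where
  "stability_number G = Max (card ` {S. stable_set G S})"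

definition max_stable_sets :: "'a ugraph \<Rightarrow> 'a set set" where
  "max_stable_sets G = {S. stable_set G S \<and> card S = stability_number G}"

definition xi :: "'a ugraph \<Rightarrow> nat" where
  "xi G = card (\<Inter> (max_stable_sets G))"

definition alpha1_plus_stable :: "'a ugraph \<Rightarrow> bool" where
  "alpha1_plus_stable G \<longleftrightarrow> xi G = 1"

definition alphaP3_plus_stable :: "'a ugraph \<Rightarrow> bool" where
  "alphaP3_plus_stable G \<longleftrightarrow>
    (\<forall>e1 \<in> gedges (complement G). \<forall>e2 \<in> gedges (complement G).
       e1 \<inter> e2 \<noteq> {} \<longrightarrow>
       stability_number (add_edge (add_edge G e1) e2) = stability_number G)"

end

theory Submission
  imports Defs
begin

text \<open>Two edges can be added to a graph without lowering its stability number precisely when some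
  maximum stable set contains neither of them. If the core of the maximum stable sets is \<open>{v}\<close>,
  deleting \<open>v\<close> is a bijection from the maximum stable sets of \<open>G\<close> to those of \<open>G - N[v]\<close>. Two added
  edges sharing an endpoint other than \<open>v\<close> are both avoided by a maximum stable set missing that
  endpoint, so only the pairs \<open>vx\<close>, \<open>vy\<close> impose a condition, and they require a maximum
  stable set of \<open>G - N[v]\<close> that misses \<open>x\<close> and \<open>y\<close>.\<close>

lemma finite_stable_sets:
  assumes "finite (gverts G)"
  shows "finite {S. stable_set G S}"
  by (rule finite_subset[of _ "Pow (gverts G)"]) (use assms in \<open>auto simp: stable_set_def\<close>)

lemma card_le_stability_number:
  assumes "finite (gverts G)" and "stable_set G S"
  shows "card S \<le> stability_number G"
  unfolding stability_number_def
  using assms finite_stable_sets[of G] by (intro Max_ge) auto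

lemma stable_set_empty: "stable_set G {}"
  by (simp add: stable_set_def indep_def)

lemma max_stable_sets_nonempty:
  assumes "finite (gverts G)"
  shows "max_stable_sets G \<noteq> {}"
proof -
  have "stability_number G \<in> card ` {S. stable_set G S}"
    unfolding stability_number_def
    using finite_stable_sets[OF assms] stable_set_empty[of G] by (intro Max_in) auto
  then show ?thesis
    by (auto simp: max_stable_sets_def)
qed

text \<open>Recognises maximum stable sets without evaluating \<open>Max\<close>: the maximum is
  attained by some stable set, whose size the last premise bounds.\<close>

lemma max_stable_setsI:
  assumes "finite (gverts G)" and "stable_set G S"
    and "\<And>T. stable_set G T \<Longrightarrow> card T \<le> card S"
  shows "S \<in> max_stable_sets G"
proof -
  obtain T where "T \<in> max_stable_sets G"
    using max_stable_sets_nonempty[OF assms(1)] by blast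
  then have "stability_number G \<le> card S"
    using assms(3)[of T] by (simp add: max_stable_sets_def)
  then show ?thesis
    using assms(2) card_le_stability_number[OF assms(1,2)]
    by (simp add: max_stable_sets_def)
qed

text \<open>\<open>indep\<close> tests only pairs of distinct vertices, so \<open>e\<close> has to
  be a genuine doubleton to forbid exactly the sets containing it.\<close>

lemma stable_set_add_edge:
  assumes "e \<in> [gverts G]\<^bsup>2\<^esup>"
  shows "stable_set (add_edge G e) S \<longleftrightarrow> stable_set G S \<and> \<not> e \<subseteq> S"
proof -
  obtain x y where "e = {x, y}" "x \<noteq> y"
    using assms by (rule nsets2_E)
  then show ?thesis
    by (auto simp: stable_set_def add_edge_def indep_def doubleton_eq_iff)
qed

text \<open>Adding edges can only destroy stable sets, so the stability number never rises; it is
  kept exactly when some stable set of the old maximum size survives. The case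
  \<open>e1 = e2\<close> is included.\<close>

lemma stability_number_add_edges_eq_iff:
  assumes "finite (gverts G)" and e1: "e1 \<in> [gverts G]\<^bsup>2\<^esup>" and e2: "e2 \<in> [gverts G]\<^bsup>2\<^esup>"
  shows "stability_number (add_edge (add_edge G e1) e2) = stability_number G \<longleftrightarrow>
    (\<exists>S \<in> max_stable_sets G. \<not> e1 \<subseteq> S \<and> \<not> e2 \<subseteq> S)"
    (is "stability_number ?H = _ \<longleftrightarrow> ?R")
proof -
  have fin: "finite (gverts ?H)"
    using assms(1) by (simp add: add_edge_def)
  have e2': "e2 \<in> [gverts (add_edge G e1)]\<^bsup>2\<^esup>"
    using e2 by (simp add: add_edge_def)
  have stable: "stable_set ?H S \<longleftrightarrow> stable_set G S \<and> \<not> e1 \<subseteq> S \<and> \<not> e2 \<subseteq> S" for S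
    by (auto simp: stable_set_add_edge[OF e1] stable_set_add_edge[OF e2'])
  \<comment> \<open>\<open>T\<close> is stable in \<open>G\<close> as well: this bounds the new
    stability number, and under equality \<open>T\<close> itself is the required witness.\<close>
  obtain T where T: "T \<in> max_stable_sets ?H"
    using max_stable_sets_nonempty[OF fin] by blast
  then have "stable_set G T" and "card T = stability_number ?H"
    using stable by (auto simp: max_stable_sets_def)
  then have le: "stability_number ?H \<le> stability_number G"
    using card_le_stability_number[OF assms(1)] by metis
  show ?thesis
  proof
    assume "stability_number ?H = stability_number G"
    then show ?R
      using T stable by (auto simp: max_stable_sets_def)
  next
    assume ?R
    then obtain S where "stable_set ?H S" "card S = stability_number G"
      using stable by (auto simp: max_stable_sets_def)
    then have "stability_number G \<le> stability_number ?H"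
      using card_le_stability_number[OF fin] by metis
    with le show "stability_number ?H = stability_number G"
      by simp
  qed
qed

text \<open>Stability keeps the neighbours of \<open>v\<close> out of \<open>S\<close>, so removing
  \<open>v\<close> leaves nothing of its closed neighbourhood. The next lemma reverses this
  step.\<close>

lemma stable_set_delete_nbhd:
  assumes "stable_set G S" and "v \<in> S"
  shows "stable_set (induced_subgraph G (gverts G - closed_nbhd G v)) (S - {v})"
  using assms
  by (auto simp: stable_set_def induced_subgraph_def indep_def closed_nbhd_def open_nbhd_def)

lemma stable_set_insert_delete_nbhd:
  assumes "v \<in> gverts G"
    and "stable_set (induced_subgraph G (gverts G - closed_nbhd G v)) S"
  shows "stable_set G (insert v S)"
  using assms
  by (auto simp: stable_set_def induced_subgraph_def indep_def closed_nbhd_def open_nbhd_def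
      insert_commute[of v] subset_iff)

text \<open>Deleting and inserting \<open>v\<close> are mutually inverse and change sizes by exactly
  one, so they preserve maximality; the core hypothesis puts \<open>v\<close> into every maximum
  stable set of \<open>G\<close>.\<close>

lemma max_stable_sets_delete_nbhd:
  assumes G: "finite_simple_graph G" and core: "{v} = \<Inter> (max_stable_sets G)"
    and G0: "G0 = induced_subgraph G (gverts G - closed_nbhd G v)"
  shows "max_stable_sets G0 = (\<lambda>S. S - {v}) ` max_stable_sets G"
proof -
  have fin: "finite (gverts G)"
    using G by (simp add: finite_simple_graph_def)
  have fin0: "finite (gverts G0)"
    using fin by (simp add: G0 induced_subgraph_def)
  have v_in: "v \<in> S" if "S \<in> max_stable_sets G" for S
    using core that by blast
  obtain M where M: "M \<in> max_stable_sets G"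
    using max_stable_sets_nonempty[OF fin] by blast
  then have M_stable: "stable_set G M" and M_card: "card M = stability_number G"
    by (auto simp: max_stable_sets_def)
  then have v: "v \<in> gverts G"
    using v_in[OF M] by (auto simp: stable_set_def)
  have card_insert: "card (insert v T) = Suc (card T)" and v_notin: "v \<notin> T"
    and insert_stable: "stable_set G (insert v T)" if "stable_set G0 T" for T
  proof -
    have T: "T \<subseteq> gverts G - closed_nbhd G v"
      using that by (simp add: stable_set_def G0 induced_subgraph_def)
    then show "v \<notin> T"
      by (auto simp: closed_nbhd_def)
    then show "card (insert v T) = Suc (card T)"
      using T fin by (meson card_insert_disjoint finite_Diff finite_subset)
    show "stable_set G (insert v T)"
      using stable_set_insert_delete_nbhd[OF v] that by (simp add: G0)
  qed
  have delete: "S - {v} \<in> max_stable_sets G0" if S: "S \<in> max_stable_sets G" for S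
  proof (rule max_stable_setsI[OF fin0])
    have S_stable: "stable_set G S" and S_card: "card S = stability_number G"
      using S by (auto simp: max_stable_sets_def)
    show "stable_set G0 (S - {v})"
      unfolding G0 by (rule stable_set_delete_nbhd[OF S_stable v_in[OF S]])
    fix T
    assume T: "stable_set G0 T"
    have "Suc (card T) \<le> card S"
      using card_le_stability_number[OF fin insert_stable[OF T]] card_insert[OF T] S_card by simp
    then show "card T \<le> card (S - {v})"
      using v_in[OF S] by simp
  qed
  have "S \<in> (\<lambda>S. S - {v}) ` max_stable_sets G" if S: "S \<in> max_stable_sets G0" for S
  proof (rule image_eqI)
    have S_stable: "stable_set G0 S"
      using S by (simp add: max_stable_sets_def)
    show "S = insert v S - {v}"
      using v_notin[OF S_stable] by simp
    \<comment> \<open>\<open>M\<close> calibrates the sizes: \<open>M - {v}\<close> is also maximum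
      in \<open>G0\<close>, so inserting \<open>v\<close> into \<open>S\<close> gives back the size
      of \<open>M\<close>.\<close>
    have "card S = card (M - {v})"
      using S delete[OF M] by (simp add: max_stable_sets_def)
    moreover have "finite M"
      using M_stable fin by (auto simp: stable_set_def intro: finite_subset)
    ultimately have "card (insert v S) = stability_number G"
      using card_insert[OF S_stable] card.remove[OF _ v_in[OF M]] M_card by simp
    then show "insert v S \<in> max_stable_sets G"
      using insert_stable[OF S_stable] by (simp add: max_stable_sets_def)
  qed
  with delete show ?thesis
    by blast
qed

theorem theorem2:
  fixes G G0 :: "'a ugraph" and v :: 'a
  assumes "finite_simple_graph G"
    and "alpha1_plus_stable G"
    and "{v} = \<Inter> (max_stable_sets G)"
    and "G0 = induced_subgraph G (gverts G - closed_nbhd G v)"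
  shows "alphaP3_plus_stable G \<longleftrightarrow>
    (\<forall>x \<in> gverts G0. \<forall>y \<in> gverts G0.
       \<exists>S0 \<in> max_stable_sets G0. x \<in> gverts G0 - S0 \<and> y \<in> gverts G0 - S0)"
proof -
  have fin: "finite (gverts G)"
    using assms(1) by (simp add: finite_simple_graph_def)
  have v_in: "v \<in> S" if "S \<in> max_stable_sets G" for S
    using assms(3) that by blast
  obtain M where "M \<in> max_stable_sets G"
    using max_stable_sets_nonempty[OF fin] by blast
  then have v: "v \<in> gverts G"
    using v_in by (auto simp: max_stable_sets_def stable_set_def)
  \<comment> \<open>This translates between vertices of \<open>G0\<close> and addable edges at
    \<open>v\<close>.\<close>
  have vertex0: "x \<in> gverts G0 \<longleftrightarrow> {v, x} \<in> gedges (complement G)" for x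
    using v by (auto simp: assms(4) induced_subgraph_def complement_def closed_nbhd_def
        open_nbhd_def insert_commute[of v])
  have P3: "alphaP3_plus_stable G \<longleftrightarrow>
      (\<forall>e1 \<in> gedges (complement G). \<forall>e2 \<in> gedges (complement G). e1 \<inter> e2 \<noteq> {} \<longrightarrow>
        (\<exists>S \<in> max_stable_sets G. \<not> e1 \<subseteq> S \<and> \<not> e2 \<subseteq> S))"
    unfolding alphaP3_plus_stable_def
    using stability_number_add_edges_eq_iff[OF fin] by (simp add: complement_def)
  have max0: "max_stable_sets G0 = (\<lambda>S. S - {v}) ` max_stable_sets G"
    by (rule max_stable_sets_delete_nbhd[OF assms(1,3,4)])
  have ne_v: "x \<noteq> v" if "x \<in> gverts G0" for x
    using that by (auto simp: assms(4) induced_subgraph_def closed_nbhd_def)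
  have "alphaP3_plus_stable G \<longleftrightarrow>
    (\<forall>x \<in> gverts G0. \<forall>y \<in> gverts G0. \<exists>S \<in> max_stable_sets G. x \<notin> S \<and> y \<notin> S)"
    (is "_ \<longleftrightarrow> ?R")
  proof
    assume P: "alphaP3_plus_stable G"
    show ?R
    proof (intro ballI)
      fix x y
      assume "x \<in> gverts G0" "y \<in> gverts G0"
      then have "{v, x} \<in> gedges (complement G)" "{v, y} \<in> gedges (complement G)"
        by (simp_all only: vertex0)
      moreover have "{v, x} \<inter> {v, y} \<noteq> {}"
        by simp
      ultimately have "\<exists>S \<in> max_stable_sets G. \<not> {v, x} \<subseteq> S \<and> \<not> {v, y} \<subseteq> S"
        using P[unfolded P3] by meson
      then show "\<exists>S \<in> max_stable_sets G. x \<notin> S \<and> y \<notin> S"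
        \<comment> \<open>Since \<open>v\<close> lies in \<open>S\<close>, a pair at
          \<open>v\<close> can avoid being contained in \<open>S\<close> only through its other
          end.\<close>
        using v_in by blast
    qed
  next
    assume R: ?R
    show "alphaP3_plus_stable G"
      unfolding P3
    proof (intro ballI impI)
      fix e1 e2
      assume e: "e1 \<in> gedges (complement G)" "e2 \<in> gedges (complement G)" "e1 \<inter> e2 \<noteq> {}"
      then obtain a where a: "a \<in> e1" "a \<in> e2"
        by blast
      have edge: "\<exists>b. e = {a, b}" if "e \<in> gedges (complement G)" "a \<in> e" for e
        using that by (auto simp: complement_def elim!: nsets2_E)
      obtain b c where bc: "e1 = {a, b}" "e2 = {a, c}"
        using edge[OF e(1) a(1)] edge[OF e(2) a(2)] by blast
      show "\<exists>S \<in> max_stable_sets G. \<not> e1 \<subseteq> S \<and> \<not> e2 \<subseteq> S"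
      proof (cases "a = v")
        case True
        then have "b \<in> gverts G0" "c \<in> gverts G0"
          using e(1,2) bc vertex0 by auto
        then show ?thesis
          using R bc by blast
      next
        case False
        \<comment> \<open>The core contains nothing but \<open>v\<close>, so some maximum stable set
          omits \<open>a\<close>.\<close>
        then obtain S where "S \<in> max_stable_sets G" "a \<notin> S"
          using assms(3) by blast
        then show ?thesis
          using a by blast
      qed
    qed
  qed
  \<comment> \<open>Vertices of \<open>G0\<close> differ from \<open>v\<close>, so they are missing
    from \<open>S\<close> exactly when they are missing from \<open>S - {v}\<close>.\<close>
  then show ?thesis
    using ne_v by (auto simp: max0)
qed

end
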